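(* Let $\xi\in(0,1)$ be irrational, and let $\phi$ be a positive increasing function of a real variable with $\lim_{x\to+\infty}\phi(x)=+\infty$ and $\phi(x)=O(e^{cx})$ as $x\to+\infty$ for some $c>0$. Suppose there is a constant $\kappa>0$ such that $$\phi(m)\,|||m\xi|||\geq\kappa\qquad\text{for all sufficiently large } m\in\mathbb{N}^{*}.$$ Then there exist constants $K_1,K_2>0$ such that $$\left(\sin^{2}(\mu)+\sin^{2}(\xi\mu)\,\sin^{2}((1-\xi)\mu)\right)e^{K_{1}\mu}\geq K_{2}\qquad\text{for all sufficiently large real }\mu .$$
   Context: For $\rho\in\mathbb{R}$, $|||\rho|||$ denotes the distance between $\rho$ and the nearest integer. $\mathbb{N}^*$ is the set of positive integers. *)

theory Defs
  imports Complex_Main "HOL-Library.Landau_Symbols"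
begin

definition dist_nearest_int :: "real \<Rightarrow> real"  (\<open>|||_|||\<close>)
  where "|||\<rho>||| = \<bar>\<rho> - of_int (round \<rho>)\<bar>"

end

(* Let m be the integer nearest to \<mu> / \<pi> and d = |||m \<xi>|||.  If \<bar>\<mu> - m \<pi>\<bar> \<ge> d, then Jordan's
   inequality bounds \<bar>sin \<mu>\<bar> below by 2 d / \<pi>.  Otherwise \<bar>sin (\<xi> m \<pi>)\<bar> = \<bar>sin ((1 - \<xi>) m \<pi>)\<bar> \<ge> 2 d,
   and since sin is 1-Lipschitz, replacing m \<pi> by \<mu> costs at most d, so both of the other sines
   are at least d.  Either way the trigonometric expression is at least d^4 / 4, and the
   hypotheses bound d below by a multiple of exp (- c m), where m \<le> \<mu>. *)
theory Submission
  imports Defs "HOL-Analysis.Convex"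
begin

text \<open>Since \<open>sin\<close> is concave on the interval from 0 to pi / 2, its graph lies
  above the chord joining (0, 0) to (pi / 2, 1).\<close>

lemma Jordan_sin_ge:
  fixes x :: real
  assumes "0 \<le> x" "x \<le> pi / 2"
  shows "2 / pi * x \<le> sin x"
proof -
  have "concave_on {0..pi / 2} sin"
  proof (rule f''_le0_imp_concave)
    fix x :: real
    assume "x \<in> {0..pi / 2}"
    then show "- sin x \<le> 0"
      by (simp add: sin_ge_zero)
  qed (auto intro!: derivative_eq_intros)
  from concave_onD_Icc'[OF this, of x] assms show ?thesis
    by simp
qed

lemma Jordan_abs_sin_ge:
  fixes x :: real
  assumes "\<bar>x\<bar> \<le> pi / 2"
  shows "2 / pi * \<bar>x\<bar> \<le> \<bar>sin x\<bar>"
  using Jordan_sin_ge[of x] Jordan_sin_ge[of "- x"] assms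
  by (cases "0 \<le> x") auto

text \<open>At an integer multiple of pi the sine vanishes and the cosine is 1 or -1, so the
  addition formula only changes a sign.\<close>

lemma abs_sin_add_int_pi:
  fixes x :: real
  shows "\<bar>sin (x + pi * of_int n)\<bar> = \<bar>sin x\<bar>"
proof -
  have "\<bar>cos (pi * of_int n)\<bar> = 1"
    using sin_cos_squared_add[of "pi * of_int n"] by (simp add: power2_eq_1_iff abs_if)
  then show ?thesis
    by (simp add: sin_add abs_mult)
qed

lemma abs_sin_diff_le:
  fixes x y :: real
  shows "\<bar>sin x - sin y\<bar> \<le> \<bar>x - y\<bar>"
proof -
  have "\<bar>sin x - sin y\<bar> = 2 * (\<bar>sin ((x - y) / 2)\<bar> * \<bar>cos ((x + y) / 2)\<bar>)"
    by (simp add: sin_diff_sin abs_mult)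
  also have "\<dots> \<le> 2 * (\<bar>(x - y) / 2\<bar> * 1)"
    by (intro mult_left_mono mult_mono abs_sin_x_le_abs_x) auto
  finally show ?thesis by simp
qed

lemma dist_nearest_int_nonneg: "0 \<le> |||x|||"
  by (simp add: dist_nearest_int_def)

lemma dist_nearest_int_le_half: "|||x||| \<le> 1 / 2"
  using of_int_round_abs_le[of x] by (simp add: dist_nearest_int_def abs_minus_commute)

text \<open>Removing the nearest integer from \<open>x\<close> preserves the absolute value of the
  sine and leaves an argument of size at most pi / 2, where Jordan's inequality applies.\<close>

lemma abs_sin_pi_mult_ge: "2 * |||x||| \<le> \<bar>sin (pi * x)\<bar>"
proof -
  define y where "y = x - of_int (round x)"
  have "\<bar>pi * y\<bar> \<le> pi / 2"
    using dist_nearest_int_le_half[of x] by (simp add: dist_nearest_int_def y_def abs_mult)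
  from Jordan_abs_sin_ge[OF this] have "2 * \<bar>y\<bar> \<le> \<bar>sin (pi * y)\<bar>"
    by (simp add: abs_mult)
  also have "\<dots> = \<bar>sin (pi * x)\<bar>"
    using abs_sin_add_int_pi[of "pi * y" "round x"] by (simp add: y_def algebra_simps)
  finally show ?thesis
    by (simp add: y_def dist_nearest_int_def)
qed

text \<open>The exponent 4 comes from the case of \<mu> close to m pi, where two squared sines are
  each at least d^2. The factor 1/4 comes from the other case, where the sine of \<mu> is at least d
  / 2 in absolute value.\<close>

lemma sin_sum_ge_dist_nearest_int:
  fixes \<xi> \<mu> :: real
  assumes "0 \<le> \<xi>" "\<xi> \<le> 1"
  defines "d \<equiv> |||of_int (round (\<mu> / pi)) * \<xi>|||"
  shows "(sin \<mu>)\<^sup>2 + (sin (\<xi> * \<mu>))\<^sup>2 * (sin ((1 - \<xi>) * \<mu>))\<^sup>2 \<ge> d ^ 4 / 4"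
proof -
  define m where "m = round (\<mu> / pi)"
  define \<delta> where "\<delta> = \<mu> - pi * of_int m"
  have d: "0 \<le> d" "d \<le> 1"
    using dist_nearest_int_nonneg dist_nearest_int_le_half[of "of_int m * \<xi>"]
    by (auto simp: d_def m_def)
  have \<mu>: "\<mu> = \<delta> + pi * of_int m"
    by (simp add: \<delta>_def)
  show ?thesis
  proof (cases "d \<le> \<bar>\<delta>\<bar>")
    case True
    have "\<delta> = pi * (\<mu> / pi - of_int m)"
      by (simp add: \<delta>_def field_simps)
    then have "\<bar>\<delta>\<bar> = pi * \<bar>\<mu> / pi - of_int m\<bar>"
      by (metis abs_mult abs_of_pos pi_gt_zero)
    also have "\<dots> \<le> pi * (1 / 2)"
      using of_int_round_abs_le[of "\<mu> / pi"]
      by (intro mult_left_mono) (simp_all add: m_def abs_minus_commute)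
    finally have "2 / pi * \<bar>\<delta>\<bar> \<le> \<bar>sin \<delta>\<bar>"
      by (intro Jordan_abs_sin_ge) simp
    \<comment> \<open>The slope 2 / pi exceeds 1/2 because pi < 4.\<close>
    moreover have "1 / 2 * d \<le> 2 / pi * \<bar>\<delta>\<bar>"
      using True d pi_less_4 by (intro mult_mono) (auto simp: field_simps)
    ultimately have "d / 2 \<le> \<bar>sin \<mu>\<bar>"
      using abs_sin_add_int_pi[of \<delta> m] \<mu> by simp
    then have "(d / 2)\<^sup>2 \<le> (sin \<mu>)\<^sup>2"
      using d by (simp add: abs_le_square_iff[symmetric])
    then have "d\<^sup>2 / 4 \<le> (sin \<mu>)\<^sup>2"
      by (simp add: power_divide)
    moreover have "d ^ 4 \<le> d ^ 2"
      using d by (intro power_decreasing) auto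
    moreover have "0 \<le> (sin (\<xi> * \<mu>))\<^sup>2 * (sin ((1 - \<xi>) * \<mu>))\<^sup>2"
      by simp
    ultimately show ?thesis
      by linarith
  next
    case False
    \<comment> \<open>Stated for a general factor \<open>t\<close>, to be used with both \<xi> and 1
      - \<xi>. Moving from m pi to \<mu> shifts the argument by at most \<bar>\<delta>\<bar> < d, so
      at least half of 2 d survives.\<close>
    have sq: "d\<^sup>2 \<le> (sin (t * \<mu>))\<^sup>2"
      if "2 * d \<le> \<bar>sin (t * (pi * of_int m))\<bar>" "0 \<le> t" "t \<le> 1" for t
    proof -
      have "\<bar>sin (t * \<mu>) - sin (t * (pi * of_int m))\<bar> \<le> \<bar>t * \<mu> - t * (pi * of_int m)\<bar>"
        by (rule abs_sin_diff_le)
      also have "\<dots> = t * \<bar>\<delta>\<bar>"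
        using that by (simp add: \<delta>_def abs_mult flip: right_diff_distrib)
      also have "\<dots> \<le> \<bar>\<delta>\<bar>"
        using that by (simp add: mult_left_le_one_le)
      finally have "d \<le> \<bar>sin (t * \<mu>)\<bar>"
        using that False by linarith
      then show ?thesis
        using d by (simp add: abs_le_square_iff[symmetric])
    qed
    have 1: "2 * d \<le> \<bar>sin (\<xi> * (pi * of_int m))\<bar>"
      using abs_sin_pi_mult_ge[of "of_int m * \<xi>"] by (simp add: d_def m_def mult_ac)
    \<comment> \<open>The two arguments add up to m pi, so the sines agree up to sign.\<close>
    also have "\<dots> = \<bar>sin ((1 - \<xi>) * (pi * of_int m))\<bar>"
      using abs_sin_add_int_pi[of "- (\<xi> * (pi * of_int m))" m] by (simp add: algebra_simps)
    finally have 2: "2 * d \<le> \<bar>sin ((1 - \<xi>) * (pi * of_int m))\<bar>" .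
    have "d\<^sup>2 * d\<^sup>2 \<le> (sin (\<xi> * \<mu>))\<^sup>2 * (sin ((1 - \<xi>) * \<mu>))\<^sup>2"
      using sq[OF 1] sq[OF 2] assms(1,2) by (intro mult_mono) auto
    moreover have "d ^ 4 = d\<^sup>2 * d\<^sup>2"
      by (simp flip: power_add)
    moreover have "0 \<le> (sin \<mu>)\<^sup>2" "0 \<le> d ^ 4"
      by simp_all
    ultimately show ?thesis
      by linarith
  qed
qed

theorem mainTheorem2:
  fixes \<xi> :: real and \<phi> :: "real \<Rightarrow> real"
  assumes "\<xi> \<in> {0<..<1}" and "\<xi> \<notin> \<rat>"
    and "\<And>x. \<phi> x > 0" and "mono \<phi>"
    and "filterlim \<phi> at_top at_top"
    and "\<exists>c>0. \<phi> \<in> O[at_top](\<lambda>x. exp (c * x))"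
    and "\<exists>\<kappa>>0. \<forall>\<^sub>F m :: nat in sequentially. \<phi> (real m) * |||real m * \<xi>||| \<ge> \<kappa>"
  shows "\<exists>K\<^sub>1>0. \<exists>K\<^sub>2>0. \<forall>\<^sub>F \<mu> :: real in at_top.
    ((sin \<mu>)\<^sup>2 + (sin (\<xi> * \<mu>))\<^sup>2 * (sin ((1 - \<xi>) * \<mu>))\<^sup>2) * exp (K\<^sub>1 * \<mu>) \<ge> K\<^sub>2"
proof -
  obtain c where c: "c > 0" "\<phi> \<in> O[at_top](\<lambda>x. exp (c * x))"
    using assms(6) by blast
  obtain C where C: "C > 0" "\<forall>\<^sub>F x in at_top. norm (\<phi> x) \<le> C * norm (exp (c * x))"
    using landau_o.bigE[OF c(2)] by blast
  obtain \<kappa> where \<kappa>: "\<kappa> > 0"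
    "\<forall>\<^sub>F m :: nat in sequentially. \<phi> (real m) * |||real m * \<xi>||| \<ge> \<kappa>"
    using assms(7) by blast
  have "\<forall>\<^sub>F m :: nat in sequentially. norm (\<phi> (real m)) \<le> C * norm (exp (c * real m))"
    using eventually_compose_filterlim[OF C(2) filterlim_real_sequentially] .
  with \<kappa>(2) have "\<forall>\<^sub>F m :: nat in sequentially. \<kappa> / C \<le> exp (c * real m) * |||real m * \<xi>|||"
  proof eventually_elim
    case (elim m)
    have "\<kappa> \<le> \<phi> (real m) * |||real m * \<xi>|||"
      by (fact elim(1))
    also have "\<dots> \<le> C * exp (c * real m) * |||real m * \<xi>|||"
      using elim(2) by (intro mult_right_mono dist_nearest_int_nonneg) auto
    finally show ?case
      using C(1) by (simp add: field_simps)
  qed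
  then obtain N where N: "\<kappa> / C \<le> exp (c * real m) * |||real m * \<xi>|||" if "m \<ge> N" for m
    by (auto simp: eventually_sequentially)
  \<comment> \<open>The witnesses are K1 = 4 c and K2 = (\<kappa> / C)^4 / 4, from the fourth power
    of exp (c \<mu>) d \<ge> \<kappa> / C.\<close>
  have "\<forall>\<^sub>F \<mu> in at_top. (\<kappa> / C) ^ 4 / 4
    \<le> ((sin \<mu>)\<^sup>2 + (sin (\<xi> * \<mu>))\<^sup>2 * (sin ((1 - \<xi>) * \<mu>))\<^sup>2) * exp (4 * c * \<mu>)"
    \<comment> \<open>The extra 1 absorbs the rounding error of at most 1/2: the nearest integer to
      \<mu> / pi is then at least \<open>N\<close>, and \<open>nat\<close> does not truncate
      it.\<close>
    using eventually_ge_at_top[of "pi * (real N + 1)"]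
  proof eventually_elim
    case (elim \<mu>)
    define m where "m = nat (round (\<mu> / pi))"
    define d where "d = |||real m * \<xi>|||"
    have ge: "real N + 1 \<le> \<mu> / pi"
      using elim by (simp add: field_simps)
    have near: "\<bar>of_int (round (\<mu> / pi)) - \<mu> / pi\<bar> \<le> 1 / 2"
      by (rule of_int_round_abs_le)
    have "(0 :: real) \<le> of_int (round (\<mu> / pi))"
      using near ge by linarith
    then have m: "real m = of_int (round (\<mu> / pi))"
      by (simp add: m_def)
    have "m \<ge> N"
      using near ge m by linarith
    \<comment> \<open>As \<mu> / pi \<ge> 1 and pi \<ge> 2, this gives m \<le> \<mu> / pi + 1/2
      \<le> 2 \<mu> / pi \<le> \<mu>.\<close>
    have "2 * (\<mu> / pi) \<le> pi * (\<mu> / pi)"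
      using ge pi_ge_two by (intro mult_right_mono) auto
    then have "2 * (\<mu> / pi) \<le> \<mu>"
      by simp
    then have "real m \<le> \<mu>"
      using near ge m by linarith
    have "\<kappa> / C \<le> exp (c * real m) * d"
      unfolding d_def by (rule N) fact
    also have "\<dots> \<le> exp (c * \<mu>) * d"
      using c(1) \<open>real m \<le> \<mu>\<close> by (intro mult_right_mono) (auto simp: d_def dist_nearest_int_nonneg)
    finally have "(\<kappa> / C) ^ 4 \<le> (exp (c * \<mu>) * d) ^ 4"
      using \<kappa>(1) C(1) by (intro power_mono) auto
    also have "\<dots> = d ^ 4 * exp (4 * c * \<mu>)"
      by (simp add: power_mult_distrib mult_ac flip: exp_of_nat_mult)
    finally have "(\<kappa> / C) ^ 4 / 4 \<le> d ^ 4 / 4 * exp (4 * c * \<mu>)"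
      by simp
    also have "\<dots> \<le> ((sin \<mu>)\<^sup>2 + (sin (\<xi> * \<mu>))\<^sup>2 * (sin ((1 - \<xi>) * \<mu>))\<^sup>2) * exp (4 * c * \<mu>)"
      using sin_sum_ge_dist_nearest_int[of \<xi> \<mu>] assms(1)
      by (intro mult_right_mono) (auto simp: d_def m)
    finally show ?case .
  qed
  moreover have "4 * c > 0" "(\<kappa> / C) ^ 4 / 4 > 0"
    using c(1) \<kappa>(1) C(1) by auto
  ultimately show ?thesis
    by blast
qed

end
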